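(* In the three-length setting of the context, put $\mathscr H_3=\lfloor q^{\lambda_3}/4\rfloor$. Let $F^-\subseteq F^+\subseteq\Omega_2$, put $D=F^+\setminus F^-$, and suppose $\Phi(F^-)\leq\mathscr H_3$ and $\Phi(F^+)\leq\mathscr H_3$. Set $I=\{i(x):x\in D\}$ and $J=\{j(x):x\in D\}$. For $S\subseteq D$ and $x\in D\setminus S$ define $$\delta_S(x)=\Phi(F^-\cup S\cup\{x\})-\Phi(F^-\cup S).$$ Assume that at least one of the following holds: (U$_c$) $|\{x\in D: j(x)=\ell\}|\leq 1$ for every $\ell\in I\cap J$; (U$_r$) $|\{x\in D: i(x)=\ell\}|\leq 1$ for every $\ell\in I\cap J$. Assume further that either (1) the digraph $\mathcal G(D)$ is acyclic, or (2) $\Phi(F^+)\leq\mathscr H_3-1$. Then the following greedy construction gives a feasible subset of every cardinality: set $S_0=\varnothing$; for $0\le m<|D|$ choose any $x_{m+1}\in D\setminus S_m$ minimizing $\delta_{S_m}(x)$ over $x\in D\setminus S_m$, and put $S_{m+1}=S_m\cup\{x_{m+1}\}$. Then $$|S_m|=m,\qquad \Phi(F^-\cup S_m)\leq\mathscr H_3,\qquad 0\leq m\leq |D|.$$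
   Context: Three-length setting. Let $q\ge2$ be an integer and $\mathcal X=\{0,1,\ldots,q-1\}$. For a word $x=x_1\cdots x_n\in\mathcal X^n$ put $[x]_q=\sum_{j=1}^n x_jq^{n-j}$; $\mathrm{pref}_k(x)$ and $\mathrm{suff}_k(x)$ are the length-$k$ prefix and suffix of $x$. Let $\lambda_1<\lambda_2<\lambda_3$ and $\mu_1,\mu_2,\mu_3$ be positive integers with $\sum_{i=1}^3\mu_iq^{-\lambda_i}\le 3/4$ and $\lambda_2<\lambda_3<2\lambda_2$. Put $\alpha=\lambda_3-\lambda_2$, $\beta=2\lambda_2-\lambda_3$ (so $\alpha+\beta=\lambda_2$). Let $F_1=\{x\in\mathcal X^{\lambda_1}:[x]_q<\mu_1\}$ and $\Omega_2=\{x\in\mathcal X^{\lambda_2}:\mathrm{pref}_{\lambda_1}(x)\notin F_1,\ \mathrm{suff}_{\lambda_1}(x)\notin F_1\}$. For $F\subseteq\Omega_2$ define two matrices with rows and columns indexed by $a,b\in\mathcal X^\beta$: $A_3(F)_{a,b}$ is the number of $x\in F_1\mathcal X^{\lambda_2-\lambda_1}\cup F$ with $\mathrm{pref}_\beta(x)=a$, $\mathrm{suff}_\beta(x)=b$; $C_3(F)_{a,b}$ is the number of $x\in\mathcal X^{\lambda_2}\setminus(\mathcal X^{\lambda_2-\lambda_1}F_1\cup F)$ with $\mathrm{pref}_\beta(x)=a$, $\mathrm{suff}_\beta(x)=b$. With $\mathbf e$ the all-ones vector, $\Phi(F)=\mathbf e^{\mathsf T}A_3(F)C_3(F)\mathbf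 e$. For $x\in\Omega_2$ put $i(x)=\mathrm{pref}_\beta(x)$ and $j(x)=\mathrm{suff}_\beta(x)$. For $D\subseteq\Omega_2$, $\mathcal G(D)$ is the digraph with vertex set $D$ having an arc $x\to y$, for distinct $x,y\in D$, exactly when $j(x)=i(y)$ (no loops are included). *)

theory Defs
  imports Complex_Main "Graph_Theory.Graph_Theory"
begin

(* Words over {0,...,q-1} are lists; the letter x_j of the 1-based notation is x ! (j - 1). *)
type_synonym word = "nat list"

definition words :: "nat \<Rightarrow> nat \<Rightarrow> word set" where
  "words q n = {x. length x = n \<and> set x \<subseteq> {0..<q}}"

definition word_val :: "nat \<Rightarrow> word \<Rightarrow> nat" where
  "word_val q x = (\<Sum>j = 1..length x. x ! (j - 1) * q ^ (length x - j))"

definition pref :: "nat \<Rightarrow> word \<Rightarrow> word" where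
  "pref k x = take k x"

definition suff :: "nat \<Rightarrow> word \<Rightarrow> word" where
  "suff k x = drop (length x - k) x"

definition conc :: "word set \<Rightarrow> word set \<Rightarrow> word set" where
  "conc A B = {u @ v | u v. u \<in> A \<and> v \<in> B}"

definition F1 :: "nat \<Rightarrow> nat \<Rightarrow> nat \<Rightarrow> word set" where
  "F1 q l1 \<mu>1 = {x \<in> words q l1. word_val q x < \<mu>1}"

definition Omega2 :: "nat \<Rightarrow> nat \<Rightarrow> nat \<Rightarrow> nat \<Rightarrow> word set" where
  "Omega2 q l1 l2 \<mu>1 =
     {x \<in> words q l2. pref l1 x \<notin> F1 q l1 \<mu>1 \<and> suff l1 x \<notin> F1 q l1 \<mu>1}"

(* Truncated subtraction is harmless: only used when l3 < 2 * l2. *)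
definition beta :: "nat \<Rightarrow> nat \<Rightarrow> nat" where
  "beta l2 l3 = 2 * l2 - l3"

(* Matrices with rows and columns indexed by words of length beta l2 l3 are functions of two words;
   only the entries at such words are relevant. *)
definition overlap_count :: "nat \<Rightarrow> word set \<Rightarrow> word \<Rightarrow> word \<Rightarrow> int" where
  "overlap_count b X = (\<lambda>u v. int (card {x \<in> X. pref b x = u \<and> suff b x = v}))"

definition A3 :: "nat \<Rightarrow> nat \<Rightarrow> nat \<Rightarrow> nat \<Rightarrow> nat \<Rightarrow> word set \<Rightarrow> word \<Rightarrow> word \<Rightarrow> int" where
  "A3 q l1 l2 l3 \<mu>1 F =
     overlap_count (beta l2 l3) (conc (F1 q l1 \<mu>1) (words q (l2 - l1)) \<union> F)"

definition C3 :: "nat \<Rightarrow> nat \<Rightarrow> nat \<Rightarrow> nat \<Rightarrow> nat \<Rightarrow> word set \<Rightarrow> word \<Rightarrow> word \<Rightarrow> int" where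
  "C3 q l1 l2 l3 \<mu>1 F =
     overlap_count (beta l2 l3)
       (words q l2 - (conc (words q (l2 - l1)) (F1 q l1 \<mu>1) \<union> F))"

definition mat_prod :: "'i set \<Rightarrow> ('i \<Rightarrow> 'i \<Rightarrow> int) \<Rightarrow> ('i \<Rightarrow> 'i \<Rightarrow> int) \<Rightarrow> 'i \<Rightarrow> 'i \<Rightarrow> int" where
  "mat_prod I A B = (\<lambda>u v. \<Sum>w\<in>I. A u w * B w v)"

definition bilin :: "'i set \<Rightarrow> ('i \<Rightarrow> int) \<Rightarrow> ('i \<Rightarrow> 'i \<Rightarrow> int) \<Rightarrow> ('i \<Rightarrow> int) \<Rightarrow> int" where
  "bilin I x M y = (\<Sum>u\<in>I. \<Sum>v\<in>I. x u * M u v * y v)"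

definition Phi :: "nat \<Rightarrow> nat \<Rightarrow> nat \<Rightarrow> nat \<Rightarrow> nat \<Rightarrow> word set \<Rightarrow> int" where
  "Phi q l1 l2 l3 \<mu>1 F =
     (let I = words q (beta l2 l3); e = (\<lambda>_. 1)
      in bilin I e (mat_prod I (A3 q l1 l2 l3 \<mu>1 F) (C3 q l1 l2 l3 \<mu>1 F)) e)"

definition overlap_digraph :: "nat \<Rightarrow> word set \<Rightarrow> word pair_pre_digraph" where
  "overlap_digraph b D =
     \<lparr>pverts = D, parcs = {(x, y). x \<in> D \<and> y \<in> D \<and> x \<noteq> y \<and> suff b x = pref b y}\<rparr>"

definition acyclic_digraph :: "('a, 'b) pre_digraph \<Rightarrow> bool" where
  "acyclic_digraph G \<longleftrightarrow> (\<nexists>p. pre_digraph.cycle G p)"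

definition marginal :: "('a set \<Rightarrow> int) \<Rightarrow> 'a set \<Rightarrow> 'a set \<Rightarrow> 'a \<Rightarrow> int" where
  "marginal \<phi> B S x = \<phi> (B \<union> S \<union> {x}) - \<phi> (B \<union> S)"

(* x 0 and all values of x, S beyond index card D are irrelevant. *)
definition greedy_run ::
    "('a set \<Rightarrow> 'a \<Rightarrow> int) \<Rightarrow> 'a set \<Rightarrow> (nat \<Rightarrow> 'a) \<Rightarrow> (nat \<Rightarrow> 'a set) \<Rightarrow> bool" where
  "greedy_run \<delta> D x S \<longleftrightarrow>
     S 0 = {} \<and>
     (\<forall>m < card D. is_arg_min (\<delta> (S m)) (\<lambda>y. y \<in> D - S m) (x (Suc m)) \<and>
                   S (Suc m) = S m \<union> {x (Suc m)})"

end

theory Submission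
  imports Defs
begin

text \<open>
  Since \<open>F\<^sup>+ \<subseteq> \<Omega>\<^sub>2\<close>, adding a set \<open>S \<subseteq> D\<close> to \<open>F\<^sup>-\<close> raises the column sums of \<open>A\<^sub>3\<close> and lowers the row
  sums of \<open>C\<^sub>3\<close> by the overlap counts of \<open>S\<close>; hence \<open>\<Phi>(F\<^sup>- \<union> S)\<close> is a constant plus a modular function
  of \<open>S\<close> minus the number of pairs \<open>(x, y) \<in> S \<times> S\<close> with \<open>j(x) = i(y)\<close>. Consequently, with \<open>T = D - S\<close>,
  \<open>\<Phi>(F\<^sup>+) - \<Phi>(F\<^sup>- \<union> S)\<close> is the sum of the marginals \<open>\<delta>\<^sub>S(x)\<close> over \<open>x \<in> T\<close> minus the number \<open>a\<close> of arcs
  of \<open>\<G>(T)\<close>. If the least marginal \<open>d\<close> is at most \<open>0\<close>, the greedy step does not increase \<open>\<Phi>\<close>.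
  If \<open>d \<ge> 1\<close>, then \<open>\<Phi>(F\<^sup>- \<union> S) + d \<le> \<Phi>(F\<^sup>+) + a - (|T| - 1) d \<le> \<Phi>(F\<^sup>+) + a - |T| + 1\<close>, and uniqueness of
  predecessors (or of successors) gives \<open>a \<le> |T|\<close>, and \<open>a \<le> |T| - 1\<close> in the acyclic case.
\<close>

section \<open>Relations with unique predecessors or successors\<close>

lemma card_inj_on_snd_le:
  assumes "finite T" "R \<subseteq> T \<times> T" "inj_on snd R"
  shows "card R \<le> card T"
proof -
  have "snd ` R \<subseteq> T" using assms(2) by auto
  then show ?thesis using assms by (metis card_image card_mono)
qed

text \<open>A finite acyclic relation is well-founded, so \<open>T\<close> has a minimal element. It
  has no predecessor, and the injection \<open>snd\<close> therefore misses a point of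
  \<open>T\<close>.\<close>

lemma card_inj_on_snd_less:
  assumes T: "finite T" "T \<noteq> {}" and R: "R \<subseteq> T \<times> T" "inj_on snd R" "acyclic R"
  shows "card R < card T"
proof -
  have "finite R" using T R(1) by (meson finite_SigmaI finite_subset)
  then have "wf R" using R(3) by (rule finite_acyclic_wf)
  then obtain z where z: "z \<in> T" "\<And>y. (y, z) \<in> R \<Longrightarrow> y \<notin> T"
    using T(2) by (metis ex_in_conv wfE_min)
  have "z \<notin> snd ` R"
  proof
    assume "z \<in> snd ` R"
    then obtain y where "(y, z) \<in> R" by auto
    then show False using z(2) R(1) by auto
  qed
  moreover have "snd ` R \<subseteq> T" using R(1) by auto
  ultimately have "card (snd ` R) < card T"
    using z(1) T(1) by (metis psubsetI psubset_card_mono)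
  then show ?thesis using card_image[OF R(2)] by simp
qed

text \<open>Passes from graph cycles to acyclicity of the arc relation: a pair \<open>(x, x)\<close>
  in the transitive closure gives a nonempty closed walk, and every such walk yields a
  cycle.\<close>

lemma acyclic_digraph_imp_acyclic:
  assumes "pair_wf_digraph G" "acyclic_digraph (with_proj G)"
  shows "acyclic (parcs G)"
proof (rule acyclicI, intro allI notI)
  interpret wf_digraph "with_proj G"
    using assms(1) by (simp add: wf_digraph_wp_iff)
  fix x assume "(x, x) \<in> (parcs G)\<^sup>+"
  then have "x \<rightarrow>\<^sup>+\<^bsub>with_proj G\<^esub> x" by simp
  then obtain p where p: "awalk x p x" "p \<noteq> []" using reachable1_awalk by blast
  then have "closed_w p" unfolding closed_w_def length_greater_0_conv by blast
  then have "\<exists>p. cycle p" by (rule closed_w_imp_cycle)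
  then show False using assms(2) unfolding acyclic_digraph_def by blast
qed

text \<open>The word shared along an arc lies in both \<open>i\<close> D\<open>and\<close>j
  \<open>D\<close>, so the uniqueness hypothesis applies to it. The first alternative makes
  predecessors unique, the second successors; the latter case is reduced to the former by passing to
  the converse relation.\<close>

lemma card_overlap_arcs:
  fixes i j :: "'a \<Rightarrow> 'b"
  assumes "finite D" "T \<subseteq> D" "T \<noteq> {}"
    and uniq: "(\<forall>w \<in> i ` D \<inter> j ` D. card {x \<in> D. j x = w} \<le> 1) \<or>
               (\<forall>w \<in> i ` D \<inter> j ` D. card {x \<in> D. i x = w} \<le> 1)"
  defines "E \<equiv> \<lambda>X. {(x, y). x \<in> X \<and> y \<in> X \<and> x \<noteq> y \<and> j x = i y}"
  shows "card (E T) \<le> card T" and "acyclic (E D) \<Longrightarrow> card (E T) < card T"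
proof -
  have le1: "x = y" if "card {x \<in> D. P x} \<le> 1" "x \<in> D" "y \<in> D" "P x" "P y" for P x y
  proof -
    have "finite {x \<in> D. P x}" using assms(1) by simp
    then show ?thesis using that card_le_Suc0_iff_eq[of "{x \<in> D. P x}"] by auto
  qed
  have T: "finite T" using assms(1,2) finite_subset by blast
  have sub: "E T \<subseteq> T \<times> T" "(E T)\<inverse> \<subseteq> T \<times> T" "E T \<subseteq> E D"
    using assms(2) unfolding E_def by auto
  have inj: "inj_on snd (E T) \<or> inj_on snd ((E T)\<inverse>)"
    using uniq
  proof
    assume u: "\<forall>w \<in> i ` D \<inter> j ` D. card {x \<in> D. j x = w} \<le> 1"
    have "x = x'" if "(x, y) \<in> E T" "(x', y) \<in> E T" for x x' y
    proof (rule le1[of "\<lambda>x. j x = i y"])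
      have "i y \<in> i ` D \<inter> j ` D" using that assms(2) unfolding E_def by force
      then show "card {x \<in> D. j x = i y} \<le> 1" using u by blast
    qed (use that assms(2) in \<open>auto simp: E_def\<close>)
    then show ?thesis by (auto simp: inj_on_def)
  next
    assume u: "\<forall>w \<in> i ` D \<inter> j ` D. card {x \<in> D. i x = w} \<le> 1"
    have "y = y'" if "(x, y) \<in> E T" "(x, y') \<in> E T" for x y y'
    proof (rule le1[of "\<lambda>y. i y = j x"])
      have "j x \<in> i ` D \<inter> j ` D" using that assms(2) unfolding E_def by force
      then show "card {y \<in> D. i y = j x} \<le> 1" using u by blast
    qed (use that assms(2) in \<open>auto simp: E_def\<close>)
    then show ?thesis by (auto simp: inj_on_def)
  qed
  then show "card (E T) \<le> card T"
    using card_inj_on_snd_le[OF T sub(1)] card_inj_on_snd_le[OF T sub(2)] by auto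
  assume "acyclic (E D)"
  then have "acyclic (E T)" using sub(3) by (rule acyclic_subset)
  then show "card (E T) < card T"
    using inj card_inj_on_snd_less[OF T assms(3) sub(1)] card_inj_on_snd_less[OF T assms(3) sub(2)]
    by auto
qed

section \<open>Greedy steps for quadratic set functions\<close>

text \<open>The marginal of \<open>x\<close> over \<open>S\<close> already accounts for the
  interaction of \<open>x\<close> with \<open>S\<close>, in both directions, and for the diagonal
  term \<open>e x x\<close>. Adding up marginals thus misses only the off-diagonal interactions
  inside \<open>D - S\<close>. This is why self-overlaps never enter the arc count.\<close>

lemma quadratic_increment:
  fixes f :: "'a set \<Rightarrow> int" and e :: "'a \<Rightarrow> 'a \<Rightarrow> int"
  assumes D: "finite D" "S \<subseteq> D"
    and f: "\<And>S. S \<subseteq> D \<Longrightarrow> f S = c + sum w S - (\<Sum>x\<in>S. \<Sum>y\<in>S. e x y)"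
  shows "f D = f S + (\<Sum>x\<in>D - S. f (insert x S) - f S)
                   - (\<Sum>x\<in>D - S. \<Sum>y\<in>D - S - {x}. e x y)"
proof -
  define T where "T = D - S"
  have fin: "finite S" "finite T" and disj: "S \<inter> T = {}" and DU: "D = S \<union> T"
    using D finite_subset unfolding T_def by auto
  have split: "(\<Sum>x\<in>T. \<Sum>y\<in>T. e x y) = (\<Sum>x\<in>T. e x x) + (\<Sum>x\<in>T. \<Sum>y\<in>T - {x}. e x y)"
    unfolding sum.distrib[symmetric] by (rule sum.cong) (simp_all add: fin sum.remove)
  have "f (insert x S) - f S = w x - (\<Sum>y\<in>S. e x y) - (\<Sum>y\<in>S. e y x) - e x x"
    if "x \<in> T" for x
  proof -
    have "x \<notin> S" "insert x S \<subseteq> D" using that D(2) unfolding T_def by auto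
    then show ?thesis using f[of S] f[of "insert x S"] D(2) fin by (simp add: sum.distrib)
  qed
  then have "(\<Sum>x\<in>T. f (insert x S) - f S) =
      sum w T - (\<Sum>x\<in>T. \<Sum>y\<in>S. e x y) - (\<Sum>x\<in>S. \<Sum>y\<in>T. e x y) - (\<Sum>x\<in>T. e x x)"
    by (simp add: sum_subtractf sum.swap[of _ T S])
  moreover have "f D - f S = sum w T - (\<Sum>x\<in>T. \<Sum>y\<in>S. e x y) - (\<Sum>x\<in>S. \<Sum>y\<in>T. e x y)
      - (\<Sum>x\<in>T. \<Sum>y\<in>T. e x y)"
    using f[of D] f[of S] D(2) unfolding DU
    by (simp add: sum.union_disjoint[OF fin disj] sum.distrib)
  ultimately show ?thesis using split unfolding T_def by simp
qed

text \<open>Integrality is essential: if the least marginal is positive, every marginal is at least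
  1, so the elements other than \<open>x\<close> use up at least \<open>card T - 1\<close> of the
  total allowed by the last assumption.\<close>

lemma greedy_step_le:
  fixes f :: "'a set \<Rightarrow> int"
  assumes T: "finite T"
    and x: "is_arg_min (\<lambda>x. f (insert x S) - f S) (\<lambda>x. x \<in> T) x"
    and "f S \<le> H"
    and D: "f S + (\<Sum>x\<in>T. f (insert x S) - f S) \<le> H + int (card T) - 1"
  shows "f (insert x S) \<le> H"
proof (cases "f (insert x S) - f S \<le> 0")
  case True
  then show ?thesis using assms(3) by simp
next
  case False
  have xT: "x \<in> T" and ge: "\<And>y. y \<in> T \<Longrightarrow> 1 \<le> f (insert y S) - f S"
    using x False unfolding is_arg_min_linorder by force+
  have "int (card (T - {x})) \<le> (\<Sum>y\<in>T - {x}. f (insert y S) - f S)"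
    using sum_mono[of "T - {x}" "\<lambda>_. 1" "\<lambda>y. f (insert y S) - f S"] ge by simp
  moreover have "int (card (T - {x})) = int (card T) - 1"
    using card_Suc_Diff1[OF T xT] by linarith
  moreover have "(\<Sum>y\<in>T. f (insert y S) - f S)
      = (f (insert x S) - f S) + (\<Sum>y\<in>T - {x}. f (insert y S) - f S)"
    using T xT by (rule sum.remove)
  ultimately show ?thesis using D by linarith
qed

lemma greedy_run_subset_card:
  assumes "greedy_run \<delta> D x S" "finite D" "m \<le> card D"
  shows "S m \<subseteq> D \<and> card (S m) = m"
  using assms(3)
proof (induction m)
  case 0
  then show ?case using assms(1) unfolding greedy_run_def by simp
next
  case (Suc m)
  then have "S (Suc m) = insert (x (Suc m)) (S m)" "x (Suc m) \<in> D - S m"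
    using assms(1) unfolding greedy_run_def is_arg_min_def by auto
  then show ?case using Suc assms(2) finite_subset by fastforce
qed

lemma greedy_run_exists:
  fixes \<delta> :: "'a set \<Rightarrow> 'a \<Rightarrow> int"
  assumes "finite D"
  shows "\<exists>x S. greedy_run \<delta> D x S"
proof -
  define pick where "pick = (\<lambda>X. SOME y. is_arg_min (\<delta> X) (\<lambda>y. y \<in> D - X) y)"
  have pick: "is_arg_min (\<delta> X) (\<lambda>y. y \<in> D - X) (pick X)" if "D - X \<noteq> {}" for X
  proof -
    have "\<exists>y. is_arg_min (\<delta> X) (\<lambda>y. y \<in> D - X) y"
      using assms that by (intro ex_is_arg_min_if_finite) simp_all
    then show ?thesis unfolding pick_def by (rule someI_ex)
  qed
  define S where "S = rec_nat {} (\<lambda>_ X. X \<union> {pick X})"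
  have S: "S 0 = {}" "S (Suc m) = S m \<union> {pick (S m)}" for m unfolding S_def by simp_all
  \<comment> \<open>The upper bound alone shows that a candidate remains at every stage
    \<open>m < card D\<close>.\<close>
  have "finite (S m) \<and> card (S m) \<le> m" for m
    by (induction m) (auto simp: S card_insert_if)
  then have "D - S m \<noteq> {}" if "m < card D" for m
    using that by (metis Diff_eq_empty_iff card_mono le_trans not_le)
  \<comment> \<open>The shift makes \<open>x (Suc m)\<close> equal to \<open>pick (S m)\<close>; the
    value at 0 is arbitrary.\<close>
  then have "greedy_run \<delta> D (\<lambda>m. pick (S (m - 1))) S"
    unfolding greedy_run_def using S pick by simp
  then show ?thesis by blast
qed

section \<open>The functional \<open>\<Phi>\<close> in terms of column and row sums\<close>

lemma finite_words: "finite (words q n)"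
proof -
  have "words q n = {x. set x \<subseteq> {0..<q} \<and> length x = n}" unfolding words_def by auto
  then show ?thesis using finite_lists_length_eq[of "{0..<q}" n] by simp
qed

lemma pref_in_words: "x \<in> words q n \<Longrightarrow> k \<le> n \<Longrightarrow> pref k x \<in> words q k"
  unfolding words_def pref_def by (auto dest: in_set_takeD)

lemma suff_in_words: "x \<in> words q n \<Longrightarrow> k \<le> n \<Longrightarrow> suff k x \<in> words q k"
  unfolding words_def suff_def by (auto dest: in_set_dropD)

lemma conc_words_subset:
  assumes "A \<subseteq> words q m" "B \<subseteq> words q n"
  shows "conc A B \<subseteq> words q (m + n)"
proof
  fix x assume "x \<in> conc A B"
  then obtain u v where uv: "x = u @ v" "u \<in> A" "v \<in> B" unfolding conc_def by blast
  then have "u \<in> words q m" "v \<in> words q n" using assms by auto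
  then show "x \<in> words q (m + n)" using uv(1) by (auto simp: words_def)
qed

text \<open>Summing a matrix of overlap counts over one index removes that constraint;
  \<open>P\<close> carries the constraint on the other index.\<close>

lemma sum_card_fibres:
  assumes "finite X" "finite W" "\<And>x. x \<in> X \<Longrightarrow> g x \<in> W"
  shows "(\<Sum>w\<in>W. int (card {x \<in> X. g x = w \<and> P x})) = int (card {x \<in> X. P x})"
proof -
  have "{x \<in> X. P x} = (\<Union>w\<in>W. {x \<in> X. g x = w \<and> P x})" using assms(3) by auto
  moreover have "card (\<Union>w\<in>W. {x \<in> X. g x = w \<and> P x}) = (\<Sum>w\<in>W. card {x \<in> X. g x = w \<and> P x})"
    using assms(1,2) by (intro card_UN_disjoint) auto
  ultimately show ?thesis by simp
qed

text \<open>Summing over the outer indices first turns the bilinear form into the scalar product of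
  the column sums of \<open>A3\<close> with the row sums of \<open>C3\<close>.\<close>

lemma Phi_eq_sum:
  assumes "l1 \<le> l2" "beta l2 l3 \<le> l2" "F \<subseteq> words q l2"
  shows "Phi q l1 l2 l3 \<mu>1 F =
    (\<Sum>w\<in>words q (beta l2 l3).
       int (card {x \<in> conc (F1 q l1 \<mu>1) (words q (l2 - l1)) \<union> F. suff (beta l2 l3) x = w}) *
       int (card {x \<in> words q l2 - (conc (words q (l2 - l1)) (F1 q l1 \<mu>1) \<union> F).
                    pref (beta l2 l3) x = w}))"
proof -
  let ?b = "beta l2 l3" and ?W = "words q (beta l2 l3)"
  let ?X = "conc (F1 q l1 \<mu>1) (words q (l2 - l1)) \<union> F"
  let ?Y = "words q l2 - (conc (words q (l2 - l1)) (F1 q l1 \<mu>1) \<union> F)"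
  have "F1 q l1 \<mu>1 \<subseteq> words q l1" unfolding F1_def by auto
  then have X: "?X \<subseteq> words q l2"
    using conc_words_subset[of "F1 q l1 \<mu>1" q l1 "words q (l2 - l1)" "l2 - l1"] assms(1,3) by simp
  then have finX: "finite ?X" by (rule finite_subset) (rule finite_words)
  have A: "(\<Sum>u\<in>?W. overlap_count ?b ?X u w) = int (card {x \<in> ?X. suff ?b x = w})" for w
    unfolding overlap_count_def using finX finite_words X pref_in_words assms(2)
    by (intro sum_card_fibres) blast+
  have C: "(\<Sum>v\<in>?W. overlap_count ?b ?Y w v) = int (card {x \<in> ?Y. pref ?b x = w})" for w
    unfolding overlap_count_def using finite_words suff_in_words assms(2)
    by (subst conj_commute, intro sum_card_fibres) blast+
  have "Phi q l1 l2 l3 \<mu>1 F = (\<Sum>u\<in>?W. \<Sum>v\<in>?W. \<Sum>w\<in>?W.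
      overlap_count ?b ?X u w * overlap_count ?b ?Y w v)"
    unfolding Phi_def bilin_def mat_prod_def A3_def C3_def Let_def by simp
  also have "\<dots> = (\<Sum>u\<in>?W. \<Sum>w\<in>?W. \<Sum>v\<in>?W. overlap_count ?b ?X u w * overlap_count ?b ?Y w v)"
    by (intro sum.cong refl sum.swap)
  also have "\<dots> = (\<Sum>w\<in>?W. \<Sum>u\<in>?W. \<Sum>v\<in>?W. overlap_count ?b ?X u w * overlap_count ?b ?Y w v)"
    by (rule sum.swap)
  also have "\<dots> = (\<Sum>w\<in>?W. (\<Sum>u\<in>?W. overlap_count ?b ?X u w) * (\<Sum>v\<in>?W. overlap_count ?b ?Y w v))"
    by (simp add: sum_product)
  finally show ?thesis unfolding A C .
qed

text \<open>After expansion, the product of the two counts of \<open>S\<close> at \<open>w\<close>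
  counts pairs with \<open>j x = w = i y\<close>; summing over \<open>w\<close> leaves the pairs
  with \<open>j x = i y\<close>.\<close>

lemma sum_mult_counts:
  fixes p r :: "'b \<Rightarrow> int" and i j :: "'a \<Rightarrow> 'b"
  assumes "finite W" "finite S" "\<And>x. x \<in> S \<Longrightarrow> i x \<in> W" "\<And>x. x \<in> S \<Longrightarrow> j x \<in> W"
  shows "(\<Sum>w\<in>W. (p w + int (card {x \<in> S. j x = w})) * (r w - int (card {x \<in> S. i x = w})))
    = (\<Sum>w\<in>W. p w * r w) + (\<Sum>x\<in>S. r (j x) - p (i x)) - (\<Sum>x\<in>S. \<Sum>y\<in>S. of_bool (j x = i y))"
proof -
  have card: "int (card {x \<in> S. g x = w}) = (\<Sum>x\<in>S. of_bool (g x = w))" for g :: "'a \<Rightarrow> 'b" and w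
    using assms(2) by (simp add: Int_def)
  have eval: "(\<Sum>w\<in>W. \<Sum>x\<in>S. h w * of_bool (g x = w)) = (\<Sum>x\<in>S. h (g x))"
    if "\<And>x. x \<in> S \<Longrightarrow> g x \<in> W" for g :: "'a \<Rightarrow> 'b" and h :: "'b \<Rightarrow> int"
  proof -
    have "(\<Sum>w\<in>W. \<Sum>x\<in>S. h w * of_bool (g x = w)) = (\<Sum>x\<in>S. \<Sum>w\<in>W. h w * of_bool (g x = w))"
      by (rule sum.swap)
    also have "\<dots> = (\<Sum>x\<in>S. \<Sum>w\<in>W. if g x = w then h w else 0)"
      by (intro sum.cong refl) simp
    also have "\<dots> = (\<Sum>x\<in>S. h (g x))"
      using that assms(1) by (intro sum.cong refl) (simp add: sum.delta')
    finally show ?thesis .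
  qed
  have "(\<Sum>w\<in>W. (p w + int (card {x \<in> S. j x = w})) * (r w - int (card {x \<in> S. i x = w})))
    = (\<Sum>w\<in>W. p w * r w) + (\<Sum>w\<in>W. \<Sum>x\<in>S. r w * of_bool (j x = w))
      - (\<Sum>w\<in>W. \<Sum>x\<in>S. p w * of_bool (i x = w))
      - (\<Sum>w\<in>W. \<Sum>x\<in>S. (\<Sum>y\<in>S. of_bool (i y = w)) * of_bool (j x = w))"
    unfolding card sum_distrib_left[symmetric] sum.distrib[symmetric] sum_subtractf[symmetric]
    by (intro sum.cong refl) (simp add: algebra_simps)
  \<comment> \<open>\<open>eval\<close> is used three times, with \<open>h\<close> equal to
    \<open>r\<close>, to \<open>p\<close>, and to the count of \<open>y\<close> in \<open>S\<close>
    with \<open>i y = w\<close>.\<close>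
  also have "\<dots> = (\<Sum>w\<in>W. p w * r w) + (\<Sum>x\<in>S. r (j x)) - (\<Sum>x\<in>S. p (i x))
      - (\<Sum>x\<in>S. \<Sum>y\<in>S. of_bool (i y = j x))"
    by (simp only: eval assms(3,4))
  finally show ?thesis by (simp add: sum_subtractf eq_commute)
qed

text \<open>Words of \<open>Omega2\<close> have neither prefix nor suffix in \<open>F1\<close>.
  Hence each word of \<open>S\<close> is new among those counted by \<open>A3\<close> and is really
  removed from those counted by \<open>C3\<close>, so the counts at \<open>Fminus\<close> shift by
  exactly the counts of \<open>S\<close>.\<close>

lemma Phi_union_quadratic:
  assumes l: "l1 \<le> l2" "beta l2 l3 \<le> l2" and F: "Fplus \<subseteq> Omega2 q l1 l2 \<mu>1" "Fminus \<subseteq> Fplus"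
  obtains c w where "\<And>S. S \<subseteq> Fplus - Fminus \<Longrightarrow> Phi q l1 l2 l3 \<mu>1 (Fminus \<union> S) =
    c + sum w S - (\<Sum>x\<in>S. \<Sum>y\<in>S. of_bool (suff (beta l2 l3) x = pref (beta l2 l3) y))"
proof -
  define b where "b = beta l2 l3"
  define P where "P = conc (F1 q l1 \<mu>1) (words q (l2 - l1))"
  define Q where "Q = conc (words q (l2 - l1)) (F1 q l1 \<mu>1)"
  define p where "p = (\<lambda>w. int (card {x \<in> P \<union> Fminus. suff b x = w}))"
  define r where "r = (\<lambda>w. int (card {x \<in> words q l2 - (Q \<union> Fminus). pref b x = w}))"
  have sub: "Fplus \<subseteq> words q l2" using F(1) unfolding Omega2_def by auto
  have P: "P \<inter> Omega2 q l1 l2 \<mu>1 = {}"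
  proof (rule equals0I)
    fix x assume x: "x \<in> P \<inter> Omega2 q l1 l2 \<mu>1"
    then obtain u v where uv: "x = u @ v" "u \<in> F1 q l1 \<mu>1" unfolding P_def conc_def by blast
    then have "pref l1 x = u" by (simp add: pref_def F1_def words_def)
    then show False using x uv(2) unfolding Omega2_def by blast
  qed
  have Q: "Q \<inter> Omega2 q l1 l2 \<mu>1 = {}"
  proof (rule equals0I)
    fix x assume x: "x \<in> Q \<inter> Omega2 q l1 l2 \<mu>1"
    then obtain u v where uv: "x = u @ v" "v \<in> F1 q l1 \<mu>1" unfolding Q_def conc_def by blast
    then have "suff l1 x = v" by (simp add: suff_def F1_def words_def)
    then show False using x uv(2) unfolding Omega2_def by blast
  qed
  have "P \<subseteq> words q (l1 + (l2 - l1))"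
    unfolding P_def by (rule conc_words_subset) (auto simp: F1_def)
  then have finP: "finite (P \<union> Fminus)"
    using sub F(2) l(1) finite_words by (metis finite_subset le_add_diff_inverse order.trans finite_UnI)
  have "Phi q l1 l2 l3 \<mu>1 (Fminus \<union> S) = (\<Sum>w\<in>words q b. p w * r w)
      + (\<Sum>x\<in>S. r (suff b x) - p (pref b x)) - (\<Sum>x\<in>S. \<Sum>y\<in>S. of_bool (suff b x = pref b y))"
    if S: "S \<subseteq> Fplus - Fminus" for S
  proof -
    have SO: "S \<subseteq> Omega2 q l1 l2 \<mu>1" "S \<inter> Fminus = {}" "S \<subseteq> words q l2"
      using S F sub by auto
    have finS: "finite S" using SO(3) finite_words finite_subset by blast
    have col: "int (card {x \<in> P \<union> (Fminus \<union> S). suff b x = w}) = p w + int (card {x \<in> S. suff b x = w})"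
      for w
    proof -
      have "{x \<in> P \<union> (Fminus \<union> S). suff b x = w}
          = {x \<in> P \<union> Fminus. suff b x = w} \<union> {x \<in> S. suff b x = w}" by auto
      moreover have "{x \<in> P \<union> Fminus. suff b x = w} \<inter> {x \<in> S. suff b x = w} = {}"
        using P SO by auto
      ultimately show ?thesis
        unfolding p_def using finP finS by (simp add: card_Un_disjoint)
    qed
    have row: "int (card {x \<in> words q l2 - (Q \<union> (Fminus \<union> S)). pref b x = w})
        = r w - int (card {x \<in> S. pref b x = w})" for w
    proof -
      let ?Y = "{x \<in> words q l2 - (Q \<union> Fminus). pref b x = w}"
      have "{x \<in> words q l2 - (Q \<union> (Fminus \<union> S)). pref b x = w} = ?Y - {x \<in> S. pref b x = w}"
        by auto
      moreover have "{x \<in> S. pref b x = w} \<subseteq> ?Y" using Q SO by auto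
      moreover have "finite ?Y" using finite_words by auto
      ultimately show ?thesis
        unfolding r_def using finS by (simp add: card_Diff_subset of_nat_diff card_mono)
    qed
    have "Fminus \<union> S \<subseteq> words q l2" using SO(3) F(2) sub by auto
    then have "Phi q l1 l2 l3 \<mu>1 (Fminus \<union> S) = (\<Sum>w\<in>words q b.
        (p w + int (card {x \<in> S. suff b x = w})) * (r w - int (card {x \<in> S. pref b x = w})))"
      using Phi_eq_sum[OF l, of "Fminus \<union> S" q \<mu>1]
      unfolding b_def[symmetric] P_def[symmetric] Q_def[symmetric] col row by simp
    also have "\<dots> = (\<Sum>w\<in>words q b. p w * r w) + (\<Sum>x\<in>S. r (suff b x) - p (pref b x))
        - (\<Sum>x\<in>S. \<Sum>y\<in>S. of_bool (suff b x = pref b y))"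
      using SO(3) l(2) pref_in_words suff_in_words unfolding b_def[symmetric]
      by (intro sum_mult_counts finite_words finS) blast+
    finally show ?thesis .
  qed
  then show ?thesis using that unfolding b_def by blast
qed

theorem theorem11:
  fixes q l1 l2 l3 \<mu>1 \<mu>2 \<mu>3 b :: nat
    and H3 :: int
    and \<Phi> :: "word set \<Rightarrow> int"
    and Fminus Fplus D I J :: "word set"
  assumes "q \<ge> 2"
    and "0 < l1" and "l1 < l2" and "l2 < l3"
    and "0 < \<mu>1" and "0 < \<mu>2" and "0 < \<mu>3"
    and "real \<mu>1 / real q ^ l1 + real \<mu>2 / real q ^ l2 + real \<mu>3 / real q ^ l3 \<le> 3 / 4"
    and "l3 < 2 * l2"
    and "b = beta l2 l3"
    and "\<Phi> = Phi q l1 l2 l3 \<mu>1"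
    and "H3 = \<lfloor>real q ^ l3 / 4\<rfloor>"
    and "Fminus \<subseteq> Fplus" and "Fplus \<subseteq> Omega2 q l1 l2 \<mu>1"
    and "D = Fplus - Fminus"
    and "\<Phi> Fminus \<le> H3" and "\<Phi> Fplus \<le> H3"
    and "I = pref b ` D" and "J = suff b ` D"
    and "(\<forall>w \<in> I \<inter> J. card {x \<in> D. suff b x = w} \<le> 1) \<or>
         (\<forall>w \<in> I \<inter> J. card {x \<in> D. pref b x = w} \<le> 1)"
    and "acyclic_digraph (with_proj (overlap_digraph b D)) \<or> \<Phi> Fplus \<le> H3 - 1"
  shows "(\<exists>x S. greedy_run (marginal \<Phi> Fminus) D x S) \<and>
         (\<forall>x S. greedy_run (marginal \<Phi> Fminus) D x S \<longrightarrow>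
            (\<forall>m \<le> card D. S m \<subseteq> D \<and> card (S m) = m \<and> \<Phi> (Fminus \<union> S m) \<le> H3))"
proof -
  define f where "f = (\<lambda>S. \<Phi> (Fminus \<union> S))"
  define E where
    "E = (\<lambda>X. {(x, y). x \<in> X \<and> y \<in> X \<and> x \<noteq> y \<and> suff b x = pref b y})"
  have finD: "finite D"
    using assms(14,15) finite_words[of q l2] finite_subset[of D "words q l2"]
    unfolding Omega2_def by auto
  have "beta l2 l3 \<le> l2" unfolding beta_def using assms(4) by simp
  then obtain c w where fS: "\<And>S. S \<subseteq> D \<Longrightarrow> f S =
      c + sum w S - (\<Sum>x\<in>S. \<Sum>y\<in>S. of_bool (suff b x = pref b y))"
    using Phi_union_quadratic[of l1 l2 l3 Fplus q \<mu>1 Fminus] assms(3,10,11,13,14,15)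
    unfolding f_def by (metis less_imp_le)
  have fD: "f D = \<Phi> Fplus" unfolding f_def using assms(13,15) by (simp add: Un_absorb1)
  have bound: "f S + (\<Sum>x\<in>D - S. f (insert x S) - f S) \<le> H3 + int (card (D - S)) - 1"
    if S: "S \<subseteq> D" "D - S \<noteq> {}" for S
  proof -
    \<comment> \<open>The off-diagonal correction is the number of arcs of the loopless overlap
      digraph on \<open>T\<close>.\<close>
    have "(\<Sum>x\<in>T. \<Sum>y\<in>T - {x}. of_bool (suff b x = pref b y)) = int (card (E T))"
      if "finite T" for T
    proof -
      have "E T = Sigma T (\<lambda>x. {y \<in> T - {x}. suff b x = pref b y})"
        unfolding E_def by auto
      then show ?thesis using that by (simp add: card_SigmaI Int_def)
    qed
    then have eq: "f S + (\<Sum>x\<in>D - S. f (insert x S) - f S) = f D + int (card (E (D - S)))"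
      using quadratic_increment[of D S f, OF finD S(1) fS] finD by simp
    have u: "(\<forall>w \<in> pref b ` D \<inter> suff b ` D. card {x \<in> D. suff b x = w} \<le> 1) \<or>
        (\<forall>w \<in> pref b ` D \<inter> suff b ` D. card {x \<in> D. pref b x = w} \<le> 1)"
      using assms(18-20) by simp
    have le: "card (E (D - S)) \<le> card (D - S)"
      unfolding E_def by (rule card_overlap_arcs(1)[OF finD Diff_subset S(2) u])
    have less: "card (E (D - S)) < card (D - S)" if "acyclic (E D)"
      using that unfolding E_def by (rule card_overlap_arcs(2)[OF finD Diff_subset S(2) u])
    \<comment> \<open>The missing 1 comes either from the strict arc bound for acyclic digraphs or
      from the slack in \<open>\<Phi> Fplus \<le> H3 - 1\<close>.\<close>
    from assms(21) show ?thesis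
    proof
      assume "acyclic_digraph (with_proj (overlap_digraph b D))"
      moreover have "pair_wf_digraph (overlap_digraph b D)"
        by unfold_locales (auto simp: overlap_digraph_def)
      ultimately have "acyclic (parcs (overlap_digraph b D))"
        by (intro acyclic_digraph_imp_acyclic)
      then have "acyclic (E D)" unfolding overlap_digraph_def E_def by simp
      then show ?thesis using less eq fD assms(17) by fastforce
    next
      assume "\<Phi> Fplus \<le> H3 - 1"
      then show ?thesis using le eq fD by linarith
    qed
  qed
  have "S m \<subseteq> D \<and> card (S m) = m \<and> f (S m) \<le> H3"
    if run: "greedy_run (marginal \<Phi> Fminus) D x S" and m: "m \<le> card D" for x S m
    using m
  proof (induction m)
    case 0
    then show ?case using run assms(16) unfolding greedy_run_def f_def by simp
  next
    case (Suc m)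
    then have IH: "S m \<subseteq> D" "f (S m) \<le> H3" by auto
    have marg: "marginal \<Phi> Fminus (S m) = (\<lambda>x. f (insert x (S m)) - f (S m))"
      unfolding marginal_def f_def by simp
    have x: "is_arg_min (\<lambda>x. f (insert x (S m)) - f (S m)) (\<lambda>y. y \<in> D - S m) (x (Suc m))"
      and step: "S (Suc m) = insert (x (Suc m)) (S m)"
      using run Suc.prems unfolding greedy_run_def marg[symmetric] by auto
    have "D - S m \<noteq> {}" using x unfolding is_arg_min_def by blast
    then have "f (insert (x (Suc m)) (S m)) \<le> H3"
      using greedy_step_le[OF finite_Diff[OF finD] x IH(2)] bound[OF IH(1)] by blast
    then show ?case
      using greedy_run_subset_card[OF run finD Suc.prems] unfolding step by simp
  qed
  then show ?thesis using greedy_run_exists[OF finD] unfolding f_def by blast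
qed

end
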